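(* Let $b_0(s) = \begin{bmatrix} x_0(s) \\ y_0(s) \end{bmatrix}$ and $b_1(t) = \begin{bmatrix} x_1(t) \\ y_1(t) \end{bmatrix}$ be planar Bézier curves of degrees $m$ and $n$ respectively, and let $(\alpha, \beta) \in [0,1]^2$ with $(\alpha,\beta) \neq (0,0)$ be parameters $(s,t)$ at which $b_0(s)$ and $b_1(t)$ have a transversal intersection, i.e. $b_0(\alpha) = b_1(\beta)$ and the Jacobian $J(\alpha,\beta) = \begin{bmatrix} b_0'(\alpha) & -b_1'(\beta) \end{bmatrix}$ of $F(s,t) = b_0(s) - b_1(t)$ is invertible. Then the relative root condition number (in the 2-norm) of the intersection is $$\kappa_{\alpha, \beta} = \sqrt{\frac{\mu_1^2 \,(\mathbf{v} \cdot \mathbf{v}) + 2 \mu_1 \mu_2 \,|\mathbf{v} \cdot \mathbf{w}| + \mu_2^2 \,(\mathbf{w} \cdot \mathbf{w})}{\alpha^2 + \beta^2}},$$ where $\mathbf{v}, \mathbf{w} \in \mathbf{R}^2$ are the columns of the inverse Jacobian, $J^{-1}(\alpha, \beta) = \begin{bmatrix} \mathbf{v} & \mathbf{w} \end{bmatrix}$, and $$\mu_1 = \widetilde{x}_0(\alpha) + \widetilde{x}_1(\beta), \qquad \mu_2 = \widetilde{y}_0(\alpha) + \widetilde{y}_1(\beta).$$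
   Context: **Bézier curves.** $B_{j,n}(s) = \binom{n}{j}(1-s)^{n-j}s^j$ denotes the Bernstein polynomial. A planar Bézier curve of degree $n$ is $b(s) = \sum_{j=0}^n \mathbf{b}_j B_{j,n}(s)$ with control points $\mathbf{b}_j \in \mathbf{R}^2$. Each component of it is a polynomial in Bernstein form. For a polynomial $p(s) = \sum_{j=0}^n p_j B_{j,n}(s)$ given by its Bernstein coefficients $p_j \in \mathbf{R}$, set $$\widetilde{p}(s) = \sum_{j=0}^n |p_j|\, B_{j,n}(s).$$ **Root condition number (general definition).** Let $F : \mathbf{R}^N \to \mathbf{R}^N$ be a smooth function of the form $F(\mathbf{x}) = \sum_j c_j \phi_j(\mathbf{x})$ (finite sum), parameterized by the coefficients $c_j \in \mathbf{R}$, with fixed smooth basis functions $\phi_j : \mathbf{R}^N \to \mathbf{R}^N$. Let $\boldsymbol{\alpha} \neq \mathbf{0}$ be a root of $F$ at which the Jacobian $J(\boldsymbol{\alpha})$ of $F$ with respect to $\mathbf{x}$ is invertible. The relative root condition number is $$\kappa_{\boldsymbol{\alpha}} = \limsup_{\varepsilon \to 0} \frac{\|\delta\boldsymbol{\alpha}\| / \varepsilon}{\|\boldsymbol{\alpha}\|} = \lim_{\varepsilon \to 0}\left( \sup_{|\delta_j| \le \varepsilon |c_j|} \frac{\left\| J^{-1}(\boldsymbol{\alpha}) \sum_j \delta_j \phi_j(\boldsymbol{\alpha}) \right\| / \varepsilon}{\|\boldsymbol{\alpha}\|} \right),$$ with $\varepsilon \to 0$ through positive values. Here $\boldsymbol{\alpha}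 + \delta\boldsymbol{\alpha}$ is the root of the perturbed function $\sum_j (c_j + \delta_j)\phi_j(\mathbf{x})$ near $\boldsymbol{\alpha}$ (given by the implicit function theorem), and the perturbations range over all $(\delta_j)$ with $|\delta_j| \le \varepsilon |c_j|$ for every $j$. The second expression is the first-order (linearized) form, coming from $\delta\boldsymbol{\alpha} = -J^{-1}(\boldsymbol{\alpha}) \sum_j \delta_j \phi_j(\boldsymbol{\alpha}) + O(\varepsilon^2)$. **Specialization to curve intersection.** The condition number $\kappa_{\alpha,\beta}$ of the intersection is the relative root condition number $$\kappa_{\boldsymbol{\alpha}} = \lim_{\varepsilon \to 0}\left( \sup_{|\delta_j| \le \varepsilon |c_j|} \frac{\left\| J^{-1}(\boldsymbol{\alpha}) \sum_j \delta_j \phi_j(\boldsymbol{\alpha}) \right\| / \varepsilon}{\|\boldsymbol{\alpha}\|} \right)$$ with the Euclidean 2-norm, $N = 2$, $\mathbf{x} = (s,t)$, $\boldsymbol{\alpha} = (\alpha,\beta)$ and $F(s,t) = b_0(s) - b_1(t)$. The coefficients that are perturbed are all $2(m+1) + 2(n+1)$ coordinates of the control points of the two curves: $$F(s,t) = \sum_{i=0}^m c_i^{(1)} \begin{bmatrix} B_{i,m}(s) \\ 0 \end{bmatrix} + \sum_{i=0}^m c_i^{(2)} \begin{bmatrix} 0 \\ B_{i,m}(s) \end{bmatrix} + \sum_{j=0}^n c_j^{(3)} \begin{bmatrix} -B_{j,n}(t) \\ 0 \end{bmatrix} + \sum_{j=0}^n c_j^{(4)} \begin{bmatrix} 0 \\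 -B_{j,n}(t) \end{bmatrix},$$ where $c_i^{(1)}, c_i^{(2)}$ are the Bernstein coefficients of $x_0, y_0$ and $c_j^{(3)}, c_j^{(4)}$ are the Bernstein coefficients of $x_1, y_1$. *)

theory Defs
  imports "HOL-Analysis.Analysis"
begin

definition lincomb_fun ::
    "'i set \<Rightarrow> ('i \<Rightarrow> real) \<Rightarrow> ('i \<Rightarrow> real^'n \<Rightarrow> real^'n) \<Rightarrow> real^'n \<Rightarrow> real^'n" where
  "lincomb_fun I c \<phi> x = (\<Sum>j\<in>I. c j *\<^sub>R \<phi> j x)"

text \<open>
  The relative root condition number of \<open>F(x) = \<Sum>j\<in>I. c j *\<^sub>R \<phi> j x\<close> at a root \<open>a \<noteq> 0\<close> with
  invertible Jacobian, in the 2-norm and in its first-order form: the root of the perturbed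
  function is replaced by its linearization \<open>a - matrix_inv J *v (\<Sum>j\<in>I. \<delta> j *\<^sub>R \<phi> j a)\<close>.
  The limit in the definition is rendered as a relation, so that
  a claim about its value includes the existence of the limit. The supremum is taken in
  \<^typ>\<open>ereal\<close>, where it needs no boundedness side condition. Values of the perturbation
  \<open>\<delta>\<close> outside \<open>I\<close> do not enter the sum.
\<close>

definition has_root_condition_number ::
    "'i set \<Rightarrow> ('i \<Rightarrow> real) \<Rightarrow> ('i \<Rightarrow> real^'n \<Rightarrow> real^'n) \<Rightarrow> real^'n \<Rightarrow> ereal \<Rightarrow> bool" where
  "has_root_condition_number I c \<phi> a \<kappa> \<longleftrightarrow>
     ((\<lambda>\<epsilon>::real. SUP \<delta> \<in> {\<delta>. \<forall>j\<in>I. \<bar>\<delta> j\<bar> \<le> \<epsilon> * \<bar>c j\<bar>}.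
          ereal ((norm (matrix_inv (jacobian (lincomb_fun I c \<phi>) (at a))
                         *v (\<Sum>j\<in>I. \<delta> j *\<^sub>R \<phi> j a)) / \<epsilon>) / norm a))
       \<longlongrightarrow> \<kappa>) (at_right 0)"

text \<open>
  Only the control points with index at most \<open>n\<close> are used. The degree is the nominal one:
  the leading coefficient in the monomial basis may vanish.
\<close>

definition bezier :: "nat \<Rightarrow> (nat \<Rightarrow> real^2) \<Rightarrow> real \<Rightarrow> real^2" where
  "bezier n p s = (\<Sum>j\<le>n. Bernstein n j s *\<^sub>R p j)"

definition bernstein_tilde :: "nat \<Rightarrow> (nat \<Rightarrow> real) \<Rightarrow> real \<Rightarrow> real" where
  "bernstein_tilde n p s = (\<Sum>j\<le>n. \<bar>p j\<bar> * Bernstein n j s)"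

text \<open>The variable \<open>z = (s, t)\<close> is a vector with \<open>s = z $ 1\<close> and \<open>t = z $ 2\<close>.\<close>

definition curve_difference ::
    "nat \<Rightarrow> (nat \<Rightarrow> real^2) \<Rightarrow> nat \<Rightarrow> (nat \<Rightarrow> real^2) \<Rightarrow> real^2 \<Rightarrow> real^2" where
  "curve_difference m p n q z = bezier m p (z $ 1) - bezier n q (z $ 2)"

definition curve_jacobian ::
    "nat \<Rightarrow> (nat \<Rightarrow> real^2) \<Rightarrow> nat \<Rightarrow> (nat \<Rightarrow> real^2) \<Rightarrow> real \<Rightarrow> real \<Rightarrow> real^2^2" where
  "curve_jacobian m p n q \<alpha> \<beta> =
     transpose (vector [vector_derivative (bezier m p) (at \<alpha>),
                        - vector_derivative (bezier n q) (at \<beta>)])"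

definition transversal_intersection ::
    "nat \<Rightarrow> (nat \<Rightarrow> real^2) \<Rightarrow> nat \<Rightarrow> (nat \<Rightarrow> real^2) \<Rightarrow> real \<Rightarrow> real \<Rightarrow> bool" where
  "transversal_intersection m p n q \<alpha> \<beta> \<longleftrightarrow>
     bezier m p \<alpha> = bezier n q \<beta> \<and> invertible (curve_jacobian m p n q \<alpha> \<beta>)"

text \<open>The perturbed coefficients are the coordinates of all control points of both curves.\<close>

datatype coeff_index = X0 nat | Y0 nat | X1 nat | Y1 nat

definition intersection_indices :: "nat \<Rightarrow> nat \<Rightarrow> coeff_index set" where
  "intersection_indices m n = X0 ` {..m} \<union> Y0 ` {..m} \<union> X1 ` {..n} \<union> Y1 ` {..n}"

fun intersection_coeff ::
    "(nat \<Rightarrow> real^2) \<Rightarrow> (nat \<Rightarrow> real^2) \<Rightarrow> coeff_index \<Rightarrow> real" where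
  "intersection_coeff p q (X0 i) = p i $ 1"
| "intersection_coeff p q (Y0 i) = p i $ 2"
| "intersection_coeff p q (X1 j) = q j $ 1"
| "intersection_coeff p q (Y1 j) = q j $ 2"

fun intersection_basis :: "nat \<Rightarrow> nat \<Rightarrow> coeff_index \<Rightarrow> real^2 \<Rightarrow> real^2" where
  "intersection_basis m n (X0 i) z = vector [Bernstein m i (z $ 1), 0]"
| "intersection_basis m n (Y0 i) z = vector [0, Bernstein m i (z $ 1)]"
| "intersection_basis m n (X1 j) z = vector [- Bernstein n j (z $ 2), 0]"
| "intersection_basis m n (Y1 j) z = vector [0, - Bernstein n j (z $ 2)]"

lemma sum_intersection_indices:
  fixes f :: "coeff_index \<Rightarrow> 'a::comm_monoid_add"
  shows "sum f (intersection_indices m n) =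
    (\<Sum>i\<le>m. f (X0 i)) + (\<Sum>i\<le>m. f (Y0 i)) + (\<Sum>j\<le>n. f (X1 j)) + (\<Sum>j\<le>n. f (Y1 j))"
proof -
  have "sum f (X0 ` {..m} \<union> Y0 ` {..m} \<union> X1 ` {..n} \<union> Y1 ` {..n}) =
    sum f (X0 ` {..m}) + sum f (Y0 ` {..m}) + sum f (X1 ` {..n}) + sum f (Y1 ` {..n})"
    by (subst sum.union_disjoint; auto)+
  then show ?thesis
    by (simp add: intersection_indices_def sum.reindex inj_on_def)
qed

lemma lincomb_fun_intersection:
  "lincomb_fun (intersection_indices m n) (intersection_coeff p q) (intersection_basis m n) =
     curve_difference m p n q"
  by (rule ext)
    (simp add: lincomb_fun_def curve_difference_def sum_intersection_indices bezier_def
      vec_eq_iff forall_2 vector_2 sum_negf mult.commute)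

definition has_intersection_condition_number ::
    "nat \<Rightarrow> (nat \<Rightarrow> real^2) \<Rightarrow> nat \<Rightarrow> (nat \<Rightarrow> real^2) \<Rightarrow> real \<Rightarrow> real \<Rightarrow> ereal \<Rightarrow> bool" where
  "has_intersection_condition_number m p n q \<alpha> \<beta> \<kappa> \<longleftrightarrow>
     has_root_condition_number (intersection_indices m n)
       (intersection_coeff p q) (intersection_basis m n) (vector [\<alpha>, \<beta>]) \<kappa>"

end

theory Submission
  imports Defs
begin

text \<open>
  At the root, the perturbation of \<open>F\<close> is a vector whose two coordinates vary independently, and
  by nonnegativity of the Bernstein polynomials on \<open>[0, 1]\<close> they fill exactly the intervals
  \<open>[-\<epsilon> \<mu>1, \<epsilon> \<mu>1]\<close> and \<open>[-\<epsilon> \<mu>2, \<epsilon> \<mu>2]\<close>. The norm of \<open>a v + b w\<close> over this box is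
  largest at a corner, with the relative sign of \<open>a\<close> and \<open>b\<close> chosen to agree with the sign of \<open>v \<bullet> w\<close>.
  So the quotient under the limit does not depend on \<open>\<epsilon>\<close>.
\<close>

lemma norm_power2_lincomb:
  fixes v w :: "'a::real_inner"
  shows "(norm (a *\<^sub>R v + b *\<^sub>R w))\<^sup>2 = a\<^sup>2 * (v \<bullet> v) + 2 * (a * b) * (v \<bullet> w) + b\<^sup>2 * (w \<bullet> w)"
  unfolding power2_norm_eq_inner
  by (simp add: inner_simps inner_commute[of w v] power2_eq_square algebra_simps)

text \<open>After expanding the square, the two outer terms grow with \<bar>a\<bar> and
  \<bar>b\<bar>, and the cross term is at most its absolute value. This bounds the norm over the
  whole box by its value at the best corner.\<close>

lemma norm_lincomb_le:
  fixes v w :: "'a::real_inner"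
  assumes "\<bar>a\<bar> \<le> A" "\<bar>b\<bar> \<le> B"
  shows "norm (a *\<^sub>R v + b *\<^sub>R w) \<le> sqrt (A\<^sup>2 * (v \<bullet> v) + 2 * A * B * \<bar>v \<bullet> w\<bar> + B\<^sup>2 * (w \<bullet> w))"
proof (rule real_le_rsqrt)
  have "a\<^sup>2 \<le> A\<^sup>2" "b\<^sup>2 \<le> B\<^sup>2"
    using assms by (metis abs_ge_zero power2_abs power_mono)+
  then have "a\<^sup>2 * (v \<bullet> v) \<le> A\<^sup>2 * (v \<bullet> v)" "b\<^sup>2 * (w \<bullet> w) \<le> B\<^sup>2 * (w \<bullet> w)"
    by (simp_all add: mult_right_mono)
  moreover have "(a * b) * (v \<bullet> w) \<le> A * B * \<bar>v \<bullet> w\<bar>"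
  proof -
    have "(a * b) * (v \<bullet> w) \<le> (\<bar>a\<bar> * \<bar>b\<bar>) * \<bar>v \<bullet> w\<bar>"
      by (metis abs_ge_self abs_mult)
    also have "\<dots> \<le> (A * B) * \<bar>v \<bullet> w\<bar>"
      using assms by (intro mult_right_mono mult_mono) auto
    finally show ?thesis .
  qed
  ultimately show "(norm (a *\<^sub>R v + b *\<^sub>R w))\<^sup>2
      \<le> A\<^sup>2 * (v \<bullet> v) + 2 * A * B * \<bar>v \<bullet> w\<bar> + B\<^sup>2 * (w \<bullet> w)"
    unfolding norm_power2_lincomb
    by linarith
qed

text \<open>The equality case of the previous bound: the sign \<open>\<sigma>\<close> turns the
  cross term into its absolute value and disappears from the square of the second
  coefficient.\<close>

lemma norm_lincomb_aligned:
  fixes v w :: "'a::real_inner"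
  assumes "\<sigma> * (v \<bullet> w) = \<bar>v \<bullet> w\<bar>" "\<sigma>\<^sup>2 = 1"
  shows "norm (A *\<^sub>R v + (\<sigma> * B) *\<^sub>R w)
    = sqrt (A\<^sup>2 * (v \<bullet> v) + 2 * A * B * \<bar>v \<bullet> w\<bar> + B\<^sup>2 * (w \<bullet> w))"
proof -
  have "(norm (A *\<^sub>R v + (\<sigma> * B) *\<^sub>R w))\<^sup>2
      = A\<^sup>2 * (v \<bullet> v) + 2 * A * B * (\<sigma> * (v \<bullet> w)) + \<sigma>\<^sup>2 * B\<^sup>2 * (w \<bullet> w)"
    unfolding norm_power2_lincomb by (simp add: power_mult_distrib)
  then show ?thesis
    unfolding assms by (simp add: real_sqrt_unique)
qed

lemma matrix_vector_mult_vector_2: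
  fixes A :: "real^2^2"
  shows "A *v vector [a, b] = a *\<^sub>R column 1 A + b *\<^sub>R column 2 A"
  by (simp add: vec_eq_iff matrix_vector_mult_def column_def sum_2 vector_2)

lemma norm_vector_2: "norm (vector [a, b] :: real^2) = sqrt (a\<^sup>2 + b\<^sup>2)"
  by (simp add: norm_vec_def L2_set_def sum_2 vector_2)

lemma bezier_has_vector_derivative:
  "(bezier n p has_vector_derivative vector_derivative (bezier n p) (at s)) (at s)"
proof -
  have "bezier n p differentiable at s"
    unfolding bezier_def[abs_def] Bernstein_def
    by (intro differentiable_sum differentiable_scaleR differentiable_mult differentiable_power
        differentiable_diff differentiable_const differentiable_ident) auto
  then show ?thesis
    by (simp add: vector_derivative_works)
qed

text \<open>Links the Jacobian in the general condition number, the matrix of a Frechet derivative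
  on the plane, with the matrix whose columns are the tangent vectors. The chain rule through the
  two coordinate projections does this.\<close>

lemma jacobian_curve_difference:
  "jacobian (curve_difference m p n q) (at (vector [\<alpha>, \<beta>])) = curve_jacobian m p n q \<alpha> \<beta>"
proof -
  define a b where "a = vector_derivative (bezier m p) (at \<alpha>)"
    and "b = vector_derivative (bezier n q) (at \<beta>)"
  define z :: "real^2" where "z = vector [\<alpha>, \<beta>]"
  have coord: "((\<lambda>z::real^2. z $ i) has_derivative (\<lambda>h. h $ i)) (at z)" for i
    by (rule bounded_linear_imp_has_derivative) (rule bounded_linear_vec_nth)
  \<comment> \<open>The base points are written \<open>z $ 1\<close> and \<open>z $ 2\<close> so
    that the facts compose with the coordinate projections.\<close>
  have a: "(bezier m p has_derivative (\<lambda>h. h *\<^sub>R a)) (at (z $ 1))"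
    and b: "(bezier n q has_derivative (\<lambda>h. h *\<^sub>R b)) (at (z $ 2))"
    using bezier_has_vector_derivative
    by (simp_all add: a_def b_def z_def vector_2 has_vector_derivative_def)
  have "(curve_difference m p n q has_derivative (\<lambda>h. h $ 1 *\<^sub>R a - h $ 2 *\<^sub>R b)) (at z)"
    unfolding curve_difference_def[abs_def]
    by (intro has_derivative_diff has_derivative_compose[OF coord a]
        has_derivative_compose[OF coord b])
  then have "jacobian (curve_difference m p n q) (at z) = matrix (\<lambda>h. h $ 1 *\<^sub>R a - h $ 2 *\<^sub>R b)"
    by (simp add: jacobian_def frechet_derivative_at[symmetric])
  also have "\<dots> = curve_jacobian m p n q \<alpha> \<beta>"
    by (simp add: vec_eq_iff forall_2 matrix_def axis_def transpose_def curve_jacobian_def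
        vector_2 a_def b_def)
  finally show ?thesis
    by (simp add: z_def)
qed

text \<open>Every basis function has a single nonzero coordinate slot, so the abscissae of the
  control points act only on the first coordinate and the ordinates only on the second. Hence the
  two coordinates vary independently.\<close>

lemma sum_intersection_basis:
  "(\<Sum>j\<in>intersection_indices m n. \<delta> j *\<^sub>R intersection_basis m n j (vector [\<alpha>, \<beta>])) =
    vector [(\<Sum>i\<le>m. \<delta> (X0 i) * Bernstein m i \<alpha>) - (\<Sum>j\<le>n. \<delta> (X1 j) * Bernstein n j \<beta>),
            (\<Sum>i\<le>m. \<delta> (Y0 i) * Bernstein m i \<alpha>) - (\<Sum>j\<le>n. \<delta> (Y1 j) * Bernstein n j \<beta>)]"
  by (simp add: sum_intersection_indices vec_eq_iff forall_2 vector_2 sum_negf)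

text \<open>On [0, 1] the Bernstein polynomials are nonnegative, so absolute values pass to the
  coefficients alone.\<close>

lemma abs_sum_Bernstein_le:
  assumes "s \<in> {0..1}" "\<And>i. i \<le> n \<Longrightarrow> \<bar>d i\<bar> \<le> \<epsilon> * \<bar>p i\<bar>"
  shows "\<bar>\<Sum>i\<le>n. d i * Bernstein n i s\<bar> \<le> \<epsilon> * bernstein_tilde n p s"
proof -
  have "\<bar>\<Sum>i\<le>n. d i * Bernstein n i s\<bar> \<le> (\<Sum>i\<le>n. \<bar>d i * Bernstein n i s\<bar>)"
    by (rule sum_abs)
  also have "\<dots> \<le> (\<Sum>i\<le>n. (\<epsilon> * \<bar>p i\<bar>) * Bernstein n i s)"
    using assms by (intro sum_mono) (auto simp: abs_mult Bernstein_nonneg intro!: mult_right_mono)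
  also have "\<dots> = \<epsilon> * bernstein_tilde n p s"
    by (simp add: bernstein_tilde_def sum_distrib_left mult.assoc)
  finally show ?thesis .
qed

text \<open>Uses the full allowance for every coefficient. The basis functions of the second curve
  carry a minus sign, which the signs in \<open>X1\<close> and \<open>Y1\<close> undo, so that
  nothing cancels within a coordinate. The factor \<open>\<sigma>\<close> flips the second
  coordinate as a whole and thereby selects the corner of the box.\<close>

fun extremal_perturbation ::
    "(nat \<Rightarrow> real^2) \<Rightarrow> (nat \<Rightarrow> real^2) \<Rightarrow> real \<Rightarrow> real \<Rightarrow> coeff_index \<Rightarrow> real" where
  "extremal_perturbation p q \<sigma> \<epsilon> (X0 i) = \<epsilon> * \<bar>p i $ 1\<bar>"
| "extremal_perturbation p q \<sigma> \<epsilon> (Y0 i) = \<sigma> * (\<epsilon> * \<bar>p i $ 2\<bar>)"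
| "extremal_perturbation p q \<sigma> \<epsilon> (X1 j) = - (\<epsilon> * \<bar>q j $ 1\<bar>)"
| "extremal_perturbation p q \<sigma> \<epsilon> (Y1 j) = - (\<sigma> * (\<epsilon> * \<bar>q j $ 2\<bar>))"

lemma abs_extremal_perturbation:
  assumes "\<bar>\<sigma>\<bar> = 1" "\<epsilon> \<ge> 0"
  shows "\<bar>extremal_perturbation p q \<sigma> \<epsilon> j\<bar> = \<epsilon> * \<bar>intersection_coeff p q j\<bar>"
  using assms by (cases j) (simp_all add: abs_mult)

lemma sum_extremal_perturbation:
  "(\<Sum>j\<in>intersection_indices m n.
      extremal_perturbation p q \<sigma> \<epsilon> j *\<^sub>R intersection_basis m n j (vector [\<alpha>, \<beta>])) =
    vector [\<epsilon> * (bernstein_tilde m (\<lambda>i. p i $ 1) \<alpha> + bernstein_tilde n (\<lambda>j. q j $ 1) \<beta>),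
            \<sigma> * (\<epsilon> * (bernstein_tilde m (\<lambda>i. p i $ 2) \<alpha> + bernstein_tilde n (\<lambda>j. q j $ 2) \<beta>))]"
  by (simp add: sum_intersection_basis bernstein_tilde_def sum_distrib_left sum_negf
      algebra_simps)

theorem theorem4p1:
  fixes m n :: nat
    and p q :: "nat \<Rightarrow> real^2"
    and \<alpha> \<beta> \<mu>1 \<mu>2 :: real
    and v w :: "real^2"
  assumes "\<alpha> \<in> {0..1}" and "\<beta> \<in> {0..1}" and "(\<alpha>, \<beta>) \<noteq> (0, 0)"
    and "transversal_intersection m p n q \<alpha> \<beta>"
    and "v = column 1 (matrix_inv (curve_jacobian m p n q \<alpha> \<beta>))"
    and "w = column 2 (matrix_inv (curve_jacobian m p n q \<alpha> \<beta>))"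
    and "\<mu>1 = bernstein_tilde m (\<lambda>i. p i $ 1) \<alpha> + bernstein_tilde n (\<lambda>j. q j $ 1) \<beta>"
    and "\<mu>2 = bernstein_tilde m (\<lambda>i. p i $ 2) \<alpha> + bernstein_tilde n (\<lambda>j. q j $ 2) \<beta>"
  shows "has_intersection_condition_number m p n q \<alpha> \<beta>
    (ereal (sqrt ((\<mu>1\<^sup>2 * (v \<bullet> v) + 2 * \<mu>1 * \<mu>2 * \<bar>v \<bullet> w\<bar> + \<mu>2\<^sup>2 * (w \<bullet> w))
                  / (\<alpha>\<^sup>2 + \<beta>\<^sup>2))))"
proof -
  define C where "C = curve_jacobian m p n q \<alpha> \<beta>"
  define I where "I = intersection_indices m n"
  define P where "P \<delta> = (\<Sum>j\<in>I. \<delta> j *\<^sub>R intersection_basis m n j (vector [\<alpha>, \<beta>]))"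
    for \<delta> :: "coeff_index \<Rightarrow> real"
  define K where "K = sqrt (\<mu>1\<^sup>2 * (v \<bullet> v) + 2 * \<mu>1 * \<mu>2 * \<bar>v \<bullet> w\<bar> + \<mu>2\<^sup>2 * (w \<bullet> w))"
  define r where "r = sqrt (\<alpha>\<^sup>2 + \<beta>\<^sup>2)"
  \<comment> \<open>The value at \<open>v \<bullet> w = 0\<close> is 1 rather than
    \<open>sgn 0 = 0\<close>, since \<sigma> must have absolute value 1.\<close>
  define \<sigma> :: real where "\<sigma> = (if v \<bullet> w \<ge> 0 then 1 else - 1)"
  have C_mult: "matrix_inv C *v vector [a, b] = a *\<^sub>R v + b *\<^sub>R w" for a b
    using assms(5,6) by (simp add: C_def matrix_vector_mult_vector_2)
  \<comment> \<open>The corner value is homogeneous of degree 1 in the side lengths of the box, so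
    \<epsilon> factors out and later cancels against the division by \<epsilon>.\<close>
  have K_scale: "sqrt ((\<epsilon> * \<mu>1)\<^sup>2 * (v \<bullet> v) + 2 * (\<epsilon> * \<mu>1) * (\<epsilon> * \<mu>2) * \<bar>v \<bullet> w\<bar>
      + (\<epsilon> * \<mu>2)\<^sup>2 * (w \<bullet> w)) = \<epsilon> * K" if "\<epsilon> > 0" for \<epsilon>
  proof -
    have "(\<epsilon> * \<mu>1)\<^sup>2 * (v \<bullet> v) + 2 * (\<epsilon> * \<mu>1) * (\<epsilon> * \<mu>2) * \<bar>v \<bullet> w\<bar> + (\<epsilon> * \<mu>2)\<^sup>2 * (w \<bullet> w)
      = \<epsilon>\<^sup>2 * (\<mu>1\<^sup>2 * (v \<bullet> v) + 2 * \<mu>1 * \<mu>2 * \<bar>v \<bullet> w\<bar> + \<mu>2\<^sup>2 * (w \<bullet> w))"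
      by (simp add: power2_eq_square algebra_simps)
    then show ?thesis
      using that by (simp add: K_def real_sqrt_mult)
  qed
  have sup: "(SUP \<delta> \<in> {\<delta>. \<forall>j\<in>I. \<bar>\<delta> j\<bar> \<le> \<epsilon> * \<bar>intersection_coeff p q j\<bar>}.
      ereal ((norm (matrix_inv C *v P \<delta>) / \<epsilon>) / r)) = ereal (K / r)"
    if \<epsilon>: "\<epsilon> > 0" for \<epsilon>
  proof (rule antisym)
    show "(SUP \<delta> \<in> {\<delta>. \<forall>j\<in>I. \<bar>\<delta> j\<bar> \<le> \<epsilon> * \<bar>intersection_coeff p q j\<bar>}.
      ereal ((norm (matrix_inv C *v P \<delta>) / \<epsilon>) / r)) \<le> ereal (K / r)"
    proof (rule SUP_least)
      fix \<delta> assume "\<delta> \<in> {\<delta>. \<forall>j\<in>I. \<bar>\<delta> j\<bar> \<le> \<epsilon> * \<bar>intersection_coeff p q j\<bar>}"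
      then have \<delta>: "\<bar>\<delta> j\<bar> \<le> \<epsilon> * \<bar>intersection_coeff p q j\<bar>" if "j \<in> I" for j
        using that by blast
      have bd: "\<bar>\<delta> (X0 i)\<bar> \<le> \<epsilon> * \<bar>p i $ 1\<bar>" "\<bar>\<delta> (Y0 i)\<bar> \<le> \<epsilon> * \<bar>p i $ 2\<bar>" if "i \<le> m" for i
        using \<delta>[of "X0 i"] \<delta>[of "Y0 i"] that by (auto simp: I_def intersection_indices_def)
      have bd': "\<bar>\<delta> (X1 i)\<bar> \<le> \<epsilon> * \<bar>q i $ 1\<bar>" "\<bar>\<delta> (Y1 i)\<bar> \<le> \<epsilon> * \<bar>q i $ 2\<bar>" if "i \<le> n" for i
        using \<delta>[of "X1 i"] \<delta>[of "Y1 i"] that by (auto simp: I_def intersection_indices_def)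
      note le = abs_sum_Bernstein_le[OF assms(1) bd(1)] abs_sum_Bernstein_le[OF assms(1) bd(2)]
        abs_sum_Bernstein_le[OF assms(2) bd'(1)] abs_sum_Bernstein_le[OF assms(2) bd'(2)]
      \<comment> \<open>Each coordinate is a difference of one sum per curve; the triangle
        inequality adds the two bounds, which is why \<mu>1 and \<mu>2 are sums over both
        curves.\<close>
      obtain a b where ab: "P \<delta> = vector [a, b]" "\<bar>a\<bar> \<le> \<epsilon> * \<mu>1" "\<bar>b\<bar> \<le> \<epsilon> * \<mu>2"
      proof
        show "P \<delta> = vector
          [(\<Sum>i\<le>m. \<delta> (X0 i) * Bernstein m i \<alpha>) - (\<Sum>j\<le>n. \<delta> (X1 j) * Bernstein n j \<beta>),
           (\<Sum>i\<le>m. \<delta> (Y0 i) * Bernstein m i \<alpha>) - (\<Sum>j\<le>n. \<delta> (Y1 j) * Bernstein n j \<beta>)]"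
          unfolding P_def I_def by (rule sum_intersection_basis)
      qed (use le in \<open>auto simp: assms(7,8) distrib_left
          intro!: order_trans[OF abs_triangle_ineq4] add_mono\<close>)
      have "norm (matrix_inv C *v P \<delta>) \<le> \<epsilon> * K"
        using norm_lincomb_le[OF ab(2,3), of v w] \<epsilon> by (simp add: ab(1) C_mult K_scale)
      then have "norm (matrix_inv C *v P \<delta>) / \<epsilon> \<le> K"
        using \<epsilon> by (simp add: pos_divide_le_eq mult.commute)
      then have "(norm (matrix_inv C *v P \<delta>) / \<epsilon>) / r \<le> K / r"
        by (rule divide_right_mono) (simp add: r_def)
      then show "ereal ((norm (matrix_inv C *v P \<delta>) / \<epsilon>) / r) \<le> ereal (K / r)"
        by simp
    qed
    \<comment> \<open>The extremal perturbation is sent to the aligned corner, so the upper bound is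
      attained and the supremum is a maximum.\<close>
    have "norm (matrix_inv C *v P (extremal_perturbation p q \<sigma> \<epsilon>)) = \<epsilon> * K"
      unfolding P_def I_def sum_extremal_perturbation assms(7,8)[symmetric] C_mult
      by (subst norm_lincomb_aligned) (simp_all add: \<sigma>_def K_scale \<epsilon>)
    then have "ereal (K / r)
        = ereal ((norm (matrix_inv C *v P (extremal_perturbation p q \<sigma> \<epsilon>)) / \<epsilon>) / r)"
      using \<epsilon> by simp
    also have "\<dots> \<le> (SUP \<delta> \<in> {\<delta>. \<forall>j\<in>I. \<bar>\<delta> j\<bar> \<le> \<epsilon> * \<bar>intersection_coeff p q j\<bar>}.
        ereal ((norm (matrix_inv C *v P \<delta>) / \<epsilon>) / r))"
      using \<epsilon> by (intro SUP_upper) (simp add: abs_extremal_perturbation \<sigma>_def)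
    finally show "ereal (K / r) \<le> \<dots>" .
  qed
  have "((\<lambda>\<epsilon>. SUP \<delta> \<in> {\<delta>. \<forall>j\<in>I. \<bar>\<delta> j\<bar> \<le> \<epsilon> * \<bar>intersection_coeff p q j\<bar>}.
      ereal ((norm (matrix_inv C *v P \<delta>) / \<epsilon>) / r)) \<longlongrightarrow> ereal (K / r)) (at_right 0)"
    \<comment> \<open>The filter \<open>at_right 0\<close> sees only positive \<epsilon>, where the
      supremum is constant.\<close>
    by (rule tendsto_eventually) (rule eventually_mono[OF eventually_at_right_less sup])
  then show ?thesis
    \<comment> \<open>This turns the Jacobian of the linear combination into \<open>C\<close> and
      the norm of the root into \<open>r\<close>; the square root of the quotient then splits as
      \<open>K / r\<close>.\<close>
    unfolding has_intersection_condition_number_def has_root_condition_number_def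
      lincomb_fun_intersection jacobian_curve_difference norm_vector_2
    by (simp add: C_def P_def I_def K_def r_def real_sqrt_divide)
qed

end
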